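(* Fix integers $n\ge 2$, $b\ge 2$, $m\ge 1$. Add $n$ random base-$b$ numbers of length $m$ whose digits are independent and uniform on $\{0,\dots,b-1\}$; columns are numbered $C_1,\dots,C_m$ from the right, and let $\kappa_j$ be the amount carried from column $j$ to column $j+1$, i.e. $\kappa_0=0$ and $\kappa_j=\lfloor(\kappa_{j-1}+s_j)/b\rfloor$ where $s_j$ is the sum of the $n$ digits in column $j$. Let $A_1,A_2,\dots$ be independent random vectors uniform on $\{0,\dots,b-1\}^n$ and $\tau_j=\pi(A_j)\circ\cdots\circ\pi(A_1)$ the permutation obtained after $j$ iterated $b$-shuffles started at the identity. Then for all $i_1,\dots,i_m$, $$\mathbb{P}(\kappa_1=i_1,\dots,\kappa_m=i_m)=\mathbb{P}(d(\tau_1)=i_1,\dots,d(\tau_m)=i_m).$$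
   Context: For $\sigma\in S_n$, $d(\sigma)$ is the number of $i\in\{1,\dots,n-1\}$ with $\sigma(i+1)<\sigma(i)$. For $A=(a_1,\dots,a_n)\in\{0,\dots,b-1\}^n$, $\pi(A)\in S_n$ is defined by: $\pi(A)(r)$ is the rank of $a_r$ among the entries sorted increasingly, ties broken by index (smaller index counts as smaller); $\pi(A)$ for uniform $A$ is a $b$-shuffle. Composition: $(\sigma\circ\rho)(r)=\sigma(\rho(r))$. *)

theory Defs
  imports "HOL-Probability.Probability" "HOL-Combinatorics.Permutations"
begin

text \<open>
  Positions, columns and shuffle steps are numbered from 1, as in the source. The symmetric group
  \<open>S\<^sub>n\<close> is the set of functions \<open>\<sigma> :: nat \<Rightarrow> nat\<close> with \<open>\<sigma> permutes {1..n}\<close>.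
\<close>

definition descents :: "nat \<Rightarrow> (nat \<Rightarrow> nat) \<Rightarrow> nat" where
  "descents n \<sigma> = card {i \<in> {1..n - 1}. \<sigma> (i + 1) < \<sigma> i}"

text \<open>
  The rank of \<open>a r\<close> (starting at 1) counts the entries that are weakly below it in the
  lexicographic order on (entry, index). Outside of \<open>{1..n}\<close> the function is extended by the
  identity, as required by \<open>permutes\<close>.
\<close>

definition rank_perm :: "nat \<Rightarrow> (nat \<Rightarrow> nat) \<Rightarrow> nat \<Rightarrow> nat" where
  "rank_perm n a r =
     (if r \<in> {1..n} then card {s \<in> {1..n}. a s < a r \<or> (a s = a r \<and> s \<le> r)} else r)"

lemma rank_perm_permutes: "rank_perm n a permutes {1..n}"
proof (rule bij_imp_permutes)
  let ?B = "\<lambda>r. {s \<in> {1..n}. a s < a r \<or> (a s = a r \<and> s \<le> r)}"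
  have less: "rank_perm n a r < rank_perm n a t"
    if "r \<in> {1..n}" "t \<in> {1..n}" "a r < a t \<or> (a r = a t \<and> r < t)" for r t
  proof -
    have "?B r \<subseteq> ?B t" "t \<in> ?B t" "t \<notin> ?B r" using that by auto
    hence "?B r \<subset> ?B t" by blast
    hence "card (?B r) < card (?B t)" by (rule psubset_card_mono[rotated]) simp
    thus ?thesis using that by (simp only: rank_perm_def if_True)
  qed
  have inj: "inj_on (rank_perm n a) {1..n}"
  proof (rule inj_onI, rule ccontr)
    fix r t assume *: "r \<in> {1..n}" "t \<in> {1..n}" "rank_perm n a r = rank_perm n a t" "r \<noteq> t"
    then consider "a r < a t \<or> (a r = a t \<and> r < t)" | "a t < a r \<or> (a t = a r \<and> t < r)"
      by linarith
    thus False using less[of r t] less[of t r] * by cases auto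
  qed
  have "rank_perm n a r \<in> {1..n}" if "r \<in> {1..n}" for r
  proof -
    have "r \<in> ?B r" "finite (?B r)" using that by auto
    hence "card (?B r) > 0" by (subst card_gt_0_iff) blast
    moreover have "card (?B r) \<le> card {1..n}" by (rule card_mono) auto
    ultimately have "card (?B r) \<in> {1..n}" by simp
    thus ?thesis using that by (simp only: rank_perm_def if_True)
  qed
  hence "rank_perm n a ` {1..n} \<subseteq> {1..n}" by blast
  with inj show "bij_betw (rank_perm n a) {1..n} {1..n}"
    by (simp add: bij_betw_def endo_inj_surj)
qed (auto simp: rank_perm_def)

text \<open>\<open>iterated_shuffle n A j\<close> is \<open>rank_perm n (A j) \<circ> \<dots> \<circ> rank_perm n (A 1)\<close>.\<close>

primrec iterated_shuffle :: "nat \<Rightarrow> (nat \<Rightarrow> nat \<Rightarrow> nat) \<Rightarrow> nat \<Rightarrow> nat \<Rightarrow> nat" where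
  "iterated_shuffle n A 0 = id"
| "iterated_shuffle n A (Suc j) = rank_perm n (A (Suc j)) \<circ> iterated_shuffle n A j"

text \<open>
  \<open>x j r\<close> is the digit of the \<open>r\<close>-th summand in column \<open>j\<close>, columns being counted from the
  right (least significant first); \<open>carry b n x j\<close> is the amount carried out of column \<open>j\<close>.
\<close>

primrec carry :: "nat \<Rightarrow> nat \<Rightarrow> (nat \<Rightarrow> nat \<Rightarrow> nat) \<Rightarrow> nat \<Rightarrow> nat" where
  "carry b n x 0 = 0"
| "carry b n x (Suc j) = (carry b n x j + (\<Sum>r = 1..n. x (Suc j) r)) div b"

end

(*
  Both laws are uniform counts, and both are the law of the numbers of descents of
  (W(1) mod b^j, ..., W(n) mod b^j), j = 1, ..., m, for W uniform on {0, ..., b^m - 1}^n.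

  Shuffles: attach to r the number W(r) whose k-th digit is A_k(tau_{k-1}(r)). Sorting by the
  least significant digit first is radix sort, so tau_j ranks the residues W(r) mod b^j.
  Since tau_{k-1} is a permutation that depends on A_1, ..., A_{k-1} only, A |-> W is a bijection.

  Carries: let W(r) be the partial sum of the first r summands modulo b^m. The carry out of
  column j counts the times at which the partial sums wrap around modulo b^j, and these
  are the descents of W mod b^j. Taking partial sums is a bijection as well.
*)

theory Submission
  imports Defs "HOL-Number_Theory.Cong"
begin

section \<open>Independent uniform variables on a finite set\<close>

text \<open>The event splits into disjoint atoms, one for each value \<open>f\<close> of the whole
  family. Independence and uniformity give every atom the same mass, so the probability reduces to
  counting the admissible \<open>f\<close>.\<close>

lemma (in prob_space) prob_indep_uniform:
  fixes X :: "'i \<Rightarrow> 'a \<Rightarrow> 's"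
  assumes I: "finite I" "I \<noteq> {}" and S: "finite S" "S \<noteq> {}"
    and indep: "indep_vars (\<lambda>_. count_space S) X I"
    and unif: "\<And>i. i \<in> I \<Longrightarrow> distr M (count_space S) (X i) = uniform_count_measure S"
  shows "prob {\<omega> \<in> space M. P (\<lambda>i\<in>I. X i \<omega>)} =
         card {f \<in> I \<rightarrow>\<^sub>E S. P f} / real (card S) ^ card I"
proof -
  have rv: "X i \<in> measurable M (count_space S)" if "i \<in> I" for i
    using indep that by (auto simp: indep_vars_def)
  \<comment> \<open>For empty \<open>I\<close> this intersection would be \<open>UNIV\<close>
    instead of \<open>space M\<close>; this is where \<open>I \<noteq> {}\<close> matters.\<close>
  define E where "E f = (\<Inter>i\<in>I. X i -` {f i} \<inter> space M)" for f
  have E_sets: "E f \<in> sets M" if "f \<in> I \<rightarrow>\<^sub>E S" for f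
    unfolding E_def using that I by (intro sets.finite_INT measurable_sets[OF rv]) auto
  have E_prob: "prob (E f) = 1 / real (card S) ^ card I" if f: "f \<in> I \<rightarrow>\<^sub>E S" for f
  proof -
    have "prob (X i -` {f i} \<inter> space M) = 1 / card S" if i: "i \<in> I" for i
    proof -
      have fi: "f i \<in> S" using f i by auto
      have "prob (X i -` {f i} \<inter> space M) = measure (distr M (count_space S) (X i)) {f i}"
        using fi i by (subst measure_distr[OF rv]) auto
      also have "\<dots> = 1 / card S"
        using fi S by (simp add: unif[OF i] measure_uniform_count_measure)
      finally show ?thesis .
    qed
    moreover have "prob (E f) = (\<Prod>i\<in>I. prob (X i -` {f i} \<inter> space M))"
      unfolding E_def using f I by (intro indep_varsD[OF indep]) auto
    ultimately show ?thesis by (simp add: power_one_over)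
  qed
  let ?F = "{f \<in> I \<rightarrow>\<^sub>E S. P f}"
  have fin: "finite ?F" using I S by (simp add: finite_PiE)
  have "{\<omega> \<in> space M. P (\<lambda>i\<in>I. X i \<omega>)} = (\<Union>f\<in>?F. E f)"
  proof (intro equalityI subsetI)
    fix \<omega> assume \<omega>: "\<omega> \<in> {\<omega> \<in> space M. P (\<lambda>i\<in>I. X i \<omega>)}"
    have "(\<lambda>i\<in>I. X i \<omega>) \<in> ?F" using \<omega> measurable_space[OF rv] by auto
    moreover have "\<omega> \<in> E (\<lambda>i\<in>I. X i \<omega>)" using \<omega> I by (auto simp: E_def)
    ultimately show "\<omega> \<in> (\<Union>f\<in>?F. E f)" by blast
  next
    fix \<omega> assume "\<omega> \<in> (\<Union>f\<in>?F. E f)"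
    then obtain f where f: "f \<in> I \<rightarrow>\<^sub>E S" "P f" "\<omega> \<in> E f" by blast
    have "X i \<omega> = f i" if "i \<in> I" for i
      using f(3) that unfolding E_def by blast
    hence "(\<lambda>i\<in>I. X i \<omega>) = f"
      using f(1) by (auto simp: fun_eq_iff PiE_def extensional_def)
    moreover have "\<omega> \<in> space M" using f I by (auto simp: E_def)
    ultimately show "\<omega> \<in> {\<omega> \<in> space M. P (\<lambda>i\<in>I. X i \<omega>)}" using f by simp
  qed
  also have "prob (\<Union>f\<in>?F. E f) = (\<Sum>f\<in>?F. prob (E f))"
  proof (rule finite_measure_finite_Union[OF fin])
    show "disjoint_family_on E ?F"
    proof (unfold disjoint_family_on_def, intro ballI impI)
      fix f g assume fg: "f \<in> ?F" "g \<in> ?F" "f \<noteq> g"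
      then obtain i where "i \<in> I" "f i \<noteq> g i"
        using PiE_ext[of f I "\<lambda>_. S" g] by auto
      thus "E f \<inter> E g = {}" by (auto simp: E_def)
    qed
  qed (use E_sets in auto)
  also have "\<dots> = card ?F / real (card S) ^ card I"
    using E_prob by simp
  finally show ?thesis .
qed

text \<open>An injection into a finite set of the same size is onto. For the encodings of shuffles
  and of summands this replaces the construction of an inverse by a comparison of
  cardinalities.\<close>

lemma card_Collect_inj_on:
  assumes "inj_on f A" "f ` A \<subseteq> B" "finite B" "card A = card B"
  shows "card {x \<in> A. P (f x)} = card {y \<in> B. P y}"
proof -
  have "f ` A = B"
    using assms by (intro card_subset_eq) (auto simp: card_image)
  hence "f ` {x \<in> A. P (f x)} = {y \<in> B. P y}" by auto
  moreover have "inj_on f {x \<in> A. P (f x)}" using assms(1) by (rule inj_on_subset) auto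
  ultimately show ?thesis by (metis card_image)
qed

section \<open>Radix expansions\<close>

text \<open>Digits are numbered from 1, least significant first.\<close>

definition radix_val :: "nat \<Rightarrow> nat \<Rightarrow> (nat \<Rightarrow> nat) \<Rightarrow> nat" where
  "radix_val b j a = (\<Sum>k<j. a (Suc k) * b ^ k)"

lemma radix_val_0 [simp]: "radix_val b 0 a = 0"
  by (simp add: radix_val_def)

lemma radix_val_Suc [simp]: "radix_val b (Suc j) a = radix_val b j a + a (Suc j) * b ^ j"
  by (simp add: radix_val_def)

lemma radix_val_less:
  assumes "\<And>k. k \<in> {1..j} \<Longrightarrow> a k < b"
  shows "radix_val b j a < b ^ j"
  using assms
proof (induction j)
  case (Suc j)
  have "radix_val b j a < b ^ j" using Suc by auto
  moreover have "Suc (a (Suc j)) * b ^ j \<le> b * b ^ j"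
    using Suc.prems[of "Suc j"] by (intro mult_right_mono) auto
  ultimately show ?case by simp
qed simp

text \<open>Digits beyond position \<open>i\<close> contribute multiples of \<open>b ^ i\<close>,
  and the remaining part is already below \<open>b ^ i\<close>.\<close>

lemma radix_val_mod:
  assumes "i \<le> j" "\<And>k. k \<in> {1..i} \<Longrightarrow> a k < b"
  shows "radix_val b j a mod b ^ i = radix_val b i a"
  using assms(1)
proof (induction j rule: dec_induct)
  case base
  show ?case using radix_val_less[OF assms(2)] by simp
next
  case (step j)
  have "b ^ i dvd a (Suc j) * b ^ j" using step by (simp add: le_imp_power_dvd)
  thus ?case using step by (auto elim!: dvdE)
qed

text \<open>Reduction modulo powers of \<open>b\<close> recovers all truncations of the expansion,
  and two consecutive truncations differ by a single digit times a positive power of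
  \<open>b\<close>.\<close>

lemma radix_val_inject:
  assumes "radix_val b j a = radix_val b j a'"
    and "\<And>k. k \<in> {1..j} \<Longrightarrow> a k < b" "\<And>k. k \<in> {1..j} \<Longrightarrow> a' k < b"
    and "k \<in> {1..j}"
  shows "a k = a' k"
proof -
  obtain l where l: "k = Suc l" using assms(4) by (cases k) auto
  have eq: "radix_val b i a = radix_val b i a'" if "i \<le> j" for i
    using assms that radix_val_mod[of i j a b] radix_val_mod[of i j a' b] by simp
  have "b > 0" using assms(2)[OF assms(4)] by simp
  with eq[of l] eq[of k] assms(4) show ?thesis by (simp add: l)
qed

text \<open>A lower part below \<open>B\<close> cannot make up for a difference of one in the
  leading digit.\<close>

lemma radix_less_iff:
  fixes w w' a a' B :: nat
  assumes "w < B" "w' < B"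
  shows "w + a * B < w' + a' * B \<longleftrightarrow> a < a' \<or> a = a' \<and> w < w'"
proof -
  have less: "u + c * B < v + d * B" if "c < d" "u < B" for u v c d :: nat
  proof -
    have "Suc c * B \<le> d * B" using that by (intro mult_right_mono) auto
    thus ?thesis using that by simp
  qed
  show ?thesis using less[of a a' w w'] less[of a' a w' w] assms
    by (cases a a' rule: linorder_cases) auto
qed

lemma descents_cong:
  assumes "\<And>r. r \<in> {1..n} \<Longrightarrow> s r = s' r"
  shows "descents n s = descents n s'"
proof -
  have "{r \<in> {1..n - 1}. s (r + 1) < s r} = {r \<in> {1..n - 1}. s' (r + 1) < s' r}"
    using assms by fastforce
  thus ?thesis by (simp add: descents_def)
qed

section \<open>Iterated shuffles\<close>

lemma rank_perm_less_iff:
  assumes "r \<in> {1..n}" "t \<in> {1..n}"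
  shows "rank_perm n a r < rank_perm n a t \<longleftrightarrow> a r < a t \<or> (a r = a t \<and> r < t)"
proof -
  have less: "rank_perm n a r < rank_perm n a t"
    if "r \<in> {1..n}" "t \<in> {1..n}" "a r < a t \<or> (a r = a t \<and> r < t)" for r t
  proof -
    let ?B = "\<lambda>r. {s \<in> {1..n}. a s < a r \<or> (a s = a r \<and> s \<le> r)}"
    have "?B r \<subseteq> ?B t" "t \<in> ?B t" "t \<notin> ?B r" using that by auto
    hence "?B r \<subset> ?B t" by blast
    hence "card (?B r) < card (?B t)" by (rule psubset_card_mono[rotated]) simp
    thus ?thesis using that by (simp only: rank_perm_def if_True)
  qed
  show ?thesis
    using less[of r t] less[of t r] assms by (cases r t rule: linorder_cases) force+
qed

lemma rank_perm_cong:
  assumes "\<And>r. r \<in> {1..n} \<Longrightarrow> a r = a' r"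
  shows "rank_perm n a = rank_perm n a'"
proof
  fix r
  show "rank_perm n a r = rank_perm n a' r"
  proof (cases "r \<in> {1..n}")
    case True
    hence "{s \<in> {1..n}. a s < a r \<or> (a s = a r \<and> s \<le> r)} =
        {s \<in> {1..n}. a' s < a' r \<or> (a' s = a' r \<and> s \<le> r)}"
      using assms by auto
    thus ?thesis by (simp add: rank_perm_def)
  qed (auto simp: rank_perm_def)
qed

lemma iterated_shuffle_permutes: "iterated_shuffle n A j permutes {1..n}"
proof (induction j)
  case 0
  show ?case unfolding iterated_shuffle.simps by (rule permutes_id)
next
  case (Suc j)
  show ?case unfolding iterated_shuffle.simps
    by (rule permutes_compose[OF Suc rank_perm_permutes])
qed

lemma iterated_shuffle_cong:
  assumes "\<And>k r. k \<in> {1..j} \<Longrightarrow> r \<in> {1..n} \<Longrightarrow> A k r = A' k r"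
  shows "iterated_shuffle n A j = iterated_shuffle n A' j"
  using assms
proof (induction j)
  case (Suc j)
  have "rank_perm n (A (Suc j)) = rank_perm n (A' (Suc j))"
    using Suc.prems by (intro rank_perm_cong) auto
  thus ?case using Suc by simp
qed simp

text \<open>Digits are attached to elements, not to positions: before step \<open>k\<close> the
  element \<open>r\<close> has reached the position at which \<open>A k\<close> is read. The digit
  numbering from 1 explains the shift \<open>k - 1\<close>.\<close>

definition shuffle_digit :: "nat \<Rightarrow> (nat \<Rightarrow> nat \<Rightarrow> nat) \<Rightarrow> nat \<Rightarrow> nat \<Rightarrow> nat" where
  "shuffle_digit n A r k = A k (iterated_shuffle n A (k - 1) r)"

lemma shuffle_digit_less:
  assumes "\<And>k r. k \<in> {1..m} \<Longrightarrow> r \<in> {1..n} \<Longrightarrow> A k r < b" "r \<in> {1..n}" "k \<in> {1..m}"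
  shows "shuffle_digit n A r k < b"
  unfolding shuffle_digit_def
  using assms permutes_in_image[OF iterated_shuffle_permutes] by blast

text \<open>Correctness of radix sort, which rests on stability: a tie in the new digit is broken by
  the current position, and by induction that position encodes the order by the lower digits and
  finally by index.\<close>

lemma iterated_shuffle_less_iff:
  assumes "\<And>k r. k \<in> {1..j} \<Longrightarrow> r \<in> {1..n} \<Longrightarrow> A k r < b"
    and "r \<in> {1..n}" "t \<in> {1..n}"
  defines "W \<equiv> \<lambda>j r. radix_val b j (shuffle_digit n A r)"
  shows "iterated_shuffle n A j r < iterated_shuffle n A j t \<longleftrightarrow>
         W j r < W j t \<or> (W j r = W j t \<and> r < t)"
  using assms(1)
proof (induction j)
  case 0
  thus ?case by (simp add: W_def)
next
  case (Suc j)
  let ?\<tau> = "iterated_shuffle n A j"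
  have in_range: "?\<tau> r \<in> {1..n}" "?\<tau> t \<in> {1..n}"
    using assms permutes_in_image[OF iterated_shuffle_permutes] by blast+
  have bound: "W j u < b ^ j" if "u \<in> {1..n}" for u
    unfolding W_def using Suc.prems that by (intro radix_val_less shuffle_digit_less[of j]) auto
  have W_Suc: "W (Suc j) u = W j u + A (Suc j) (?\<tau> u) * b ^ j" for u
    by (simp add: W_def shuffle_digit_def)
  have IH: "?\<tau> r < ?\<tau> t \<longleftrightarrow> W j r < W j t \<or> (W j r = W j t \<and> r < t)"
    using Suc by simp
  have lt: "W (Suc j) r < W (Suc j) t \<longleftrightarrow> A (Suc j) (?\<tau> r) < A (Suc j) (?\<tau> t) \<or>
      A (Suc j) (?\<tau> r) = A (Suc j) (?\<tau> t) \<and> W j r < W j t"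
    unfolding W_Suc by (rule radix_less_iff) (use bound assms in auto)
  \<comment> \<open>The reverse comparison is recorded too, since equality of the values at
    \<open>Suc j\<close> is treated as the failure of both strict inequalities.\<close>
  have gt: "W (Suc j) t < W (Suc j) r \<longleftrightarrow> A (Suc j) (?\<tau> t) < A (Suc j) (?\<tau> r) \<or>
      A (Suc j) (?\<tau> t) = A (Suc j) (?\<tau> r) \<and> W j t < W j r"
    unfolding W_Suc by (rule radix_less_iff) (use bound assms in auto)
  have "iterated_shuffle n A (Suc j) r < iterated_shuffle n A (Suc j) t \<longleftrightarrow>
      A (Suc j) (?\<tau> r) < A (Suc j) (?\<tau> t) \<or>
      A (Suc j) (?\<tau> r) = A (Suc j) (?\<tau> t) \<and> ?\<tau> r < ?\<tau> t"
    using rank_perm_less_iff[OF in_range] by simp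
  thus ?case using IH lt gt by (metis linorder_neq_iff)
qed

text \<open>For neighbours \<open>r\<close> and \<open>r + 1\<close> the tie-break by index always
  favours \<open>r\<close>, so ties never produce a descent and the strict comparison of values
  remains. The value of the first \<open>j\<close> digits is the residue of the full number modulo
  \<open>b ^ j\<close>, so one number serves all \<open>j\<close>.\<close>

lemma descents_iterated_shuffle:
  assumes "\<And>k r. k \<in> {1..m} \<Longrightarrow> r \<in> {1..n} \<Longrightarrow> A k r < b" "j \<le> m"
  shows "descents n (iterated_shuffle n A j) =
         descents n (\<lambda>r. radix_val b m (shuffle_digit n A r) mod b ^ j)"
proof -
  have "iterated_shuffle n A j (r + 1) < iterated_shuffle n A j r \<longleftrightarrow>
      radix_val b m (shuffle_digit n A (r + 1)) mod b ^ j <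
      radix_val b m (shuffle_digit n A r) mod b ^ j" if r: "r \<in> {1..n - 1}" for r
  proof -
    have rn: "r \<in> {1..n}" "r + 1 \<in> {1..n}" using r by auto
    have "radix_val b m (shuffle_digit n A u) mod b ^ j = radix_val b j (shuffle_digit n A u)"
      if "u \<in> {1..n}" for u
      using assms that by (intro radix_val_mod shuffle_digit_less[of m]) auto
    moreover have "iterated_shuffle n A j (r + 1) < iterated_shuffle n A j r \<longleftrightarrow>
      radix_val b j (shuffle_digit n A (r + 1)) < radix_val b j (shuffle_digit n A r)"
      using iterated_shuffle_less_iff[of j n A b "r + 1" r] assms rn by auto
    ultimately show ?thesis using rn by simp
  qed
  thus ?thesis unfolding descents_def by (intro arg_cong[where f = card]) blast
qed

text \<open>Strong induction on the step: once the earlier vectors agree, the permutation before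
  step \<open>k\<close> is the same for both families, and undoing it turns the digits at
  \<open>k\<close> back into the entries of \<open>A k\<close>.\<close>

lemma shuffle_digit_inject:
  assumes eq: "\<And>r k. r \<in> {1..n} \<Longrightarrow> k \<in> {1..m} \<Longrightarrow> shuffle_digit n A r k = shuffle_digit n A' r k"
    and "k \<in> {1..m}" "r \<in> {1..n}"
  shows "A k r = A' k r"
  using assms(2,3)
proof (induction k arbitrary: r rule: less_induct)
  case (less k)
  let ?\<tau> = "iterated_shuffle n A (k - 1)"
  have \<tau>: "iterated_shuffle n A' (k - 1) = ?\<tau>"
    using less by (intro iterated_shuffle_cong) auto
  define u where "u = inv ?\<tau> r"
  have u: "?\<tau> u = r"
    unfolding u_def using permutes_inverses(1)[OF iterated_shuffle_permutes] .
  hence "u \<in> {1..n}"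
    using less.prems(2) permutes_in_image[OF iterated_shuffle_permutes] by metis
  from eq[OF this less.prems(1)] show ?case unfolding shuffle_digit_def \<tau> u .
qed

text \<open>The digits \<open>shuffle_digit\<close> encode a family of shuffles injectively as
  \<open>n\<close> numbers below \<open>b ^ m\<close>. Both spaces have \<open>b ^ (m * n)\<close>
  elements, so the encoding is a bijection, and it carries the descent condition along.\<close>

lemma card_shuffles:
  "card {A \<in> {1..m} \<rightarrow>\<^sub>E ({1..n} \<rightarrow>\<^sub>E {0..<b}). \<forall>j\<in>{1..m}. descents n (iterated_shuffle n A j) = i j} =
   card {W \<in> {1..n} \<rightarrow>\<^sub>E {0..<b ^ m}. \<forall>j\<in>{1..m}. descents n (\<lambda>r. W r mod b ^ j) = i j}"
proof -
  let ?D = "{1..m} \<rightarrow>\<^sub>E ({1..n} \<rightarrow>\<^sub>E {0..<b})" and ?E = "{1..n} \<rightarrow>\<^sub>E {0..<b ^ m}"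
  define W where "W A = (\<lambda>r\<in>{1..n}. radix_val b m (shuffle_digit n A r))" for A
  have less: "A k r < b" if "A \<in> ?D" "k \<in> {1..m}" "r \<in> {1..n}" for A k r
    using that by (force simp: PiE_iff)
  have W_descents: "descents n (iterated_shuffle n A j) = descents n (\<lambda>r. W A r mod b ^ j)"
    if "A \<in> ?D" "j \<in> {1..m}" for A j
  proof -
    have "descents n (iterated_shuffle n A j) =
        descents n (\<lambda>r. radix_val b m (shuffle_digit n A r) mod b ^ j)"
      using that less by (intro descents_iterated_shuffle) auto
    also have "\<dots> = descents n (\<lambda>r. W A r mod b ^ j)"
      by (rule descents_cong) (simp add: W_def)
    finally show ?thesis .
  qed
  have "inj_on W ?D"
  proof (rule inj_onI)
    fix A A' assume A: "A \<in> ?D" "A' \<in> ?D" and eq: "W A = W A'"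
    have digit_eq: "shuffle_digit n A r k = shuffle_digit n A' r k" if "r \<in> {1..n}" "k \<in> {1..m}" for r k
    proof (rule radix_val_inject[OF _ _ _ that(2)])
      show "radix_val b m (shuffle_digit n A r) = radix_val b m (shuffle_digit n A' r)"
        using fun_cong[OF eq, of r] that by (simp add: W_def)
    qed (use less[OF A(1)] less[OF A(2)] that in \<open>auto intro!: shuffle_digit_less[of m]\<close>)
    have "A k r = A' k r" if "k \<in> {1..m}" "r \<in> {1..n}" for k r
      by (rule shuffle_digit_inject[OF digit_eq that])
    hence "A k = A' k" if "k \<in> {1..m}" for k
      using that by (intro PiE_ext[OF PiE_mem[OF A(1)] PiE_mem[OF A(2)]]) auto
    thus "A = A'" by (rule PiE_ext[OF A])
  qed
  moreover have "W ` ?D \<subseteq> ?E"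
    using less by (auto simp: W_def intro!: radix_val_less shuffle_digit_less[of m])
  moreover have "card ?D = card ?E"
    by (simp add: card_PiE mult.commute flip: power_mult)
  ultimately have "card {A \<in> ?D. \<forall>j\<in>{1..m}. descents n (\<lambda>r. W A r mod b ^ j) = i j} =
      card {W \<in> ?E. \<forall>j\<in>{1..m}. descents n (\<lambda>r. W r mod b ^ j) = i j}"
    by (intro card_Collect_inj_on) (auto simp: finite_PiE)
  thus ?thesis using W_descents by (simp cong: conj_cong)
qed

section \<open>Carries\<close>

lemma carry_cong:
  assumes "\<And>k r. k \<in> {1..j} \<Longrightarrow> r \<in> {1..n} \<Longrightarrow> x k r = x' k r"
  shows "carry b n x j = carry b n x' j"
  using assms by (induction j) auto

text \<open>The nested floors of the recursion collapse: the column sum enters the quotient by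
  \<open>b ^ j\<close> as a multiple of \<open>b ^ j\<close>, and dividing by \<open>b ^ j\<close>
  and then by \<open>b\<close> is division by \<open>b ^ Suc j\<close>.\<close>

lemma carry_eq_div:
  assumes "b > 0"
  shows "carry b n x j = (\<Sum>r = 1..n. radix_val b j (\<lambda>k. x k r)) div b ^ j"
proof (induction j)
  case (Suc j)
  let ?T = "\<Sum>r = 1..n. radix_val b j (\<lambda>k. x k r)" and ?s = "\<Sum>r = 1..n. x (Suc j) r"
  have "(\<Sum>r = 1..n. radix_val b (Suc j) (\<lambda>k. x k r)) = ?T + ?s * b ^ j"
    by (simp add: sum.distrib sum_distrib_right)
  moreover have "(?T + ?s * b ^ j) div b ^ Suc j = (?T + ?s * b ^ j) div b ^ j div b"
    unfolding power_Suc2 by (rule div_mult2_eq)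
  ultimately show ?case using Suc assms by (simp add: add.commute)
qed simp

text \<open>Adding less than \<open>B\<close> passes at most one multiple of \<open>B\<close>, and
  passing one is visible as a drop of the residue.\<close>

lemma div_add_wrap:
  fixes T y B :: nat
  assumes "y < B"
  shows "(T + y) div B = T div B + (if (T + y) mod B < T mod B then 1 else 0)"
proof -
  define q t where "q = T div B" and "t = T mod B"
  have t: "t < B" "T = q * B + t" using assms by (auto simp: q_def t_def)
  show ?thesis
  proof (cases "t + y < B")
    case True
    hence "(T + y) div B = q" "(T + y) mod B = t + y" by (auto simp: t add.assoc)
    thus ?thesis by (simp flip: q_def t_def)
  next
    case False
    \<comment> \<open>Here \<open>t + y\<close> lies between \<open>B\<close> and
      \<open>2 * B\<close>; the new residue \<open>t + y - B\<close> is below \<open>t\<close>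
      because \<open>y < B\<close>.\<close>
    have "T + y = Suc q * B + (t + y - B)" using False t by simp
    moreover have "t + y - B < B" using t assms by simp
    ultimately have "(T + y) div B = Suc q" "(T + y) mod B = t + y - B"
      by (simp_all only: div_mult_self3 mod_mult_self3) auto
    thus ?thesis using False t(1) assms by (simp flip: q_def t_def)
  qed
qed

text \<open>The quotient starts at 0 for the first summand and grows by one exactly when adding a
  summand makes the partial sum wrap around, by \<open>div_add_wrap\<close>.\<close>

lemma sum_div_eq_descents:
  fixes Y :: "nat \<Rightarrow> nat"
  assumes "\<And>r. r \<in> {1..n} \<Longrightarrow> Y r < B"
  shows "(\<Sum>r = 1..n. Y r) div B = descents n (\<lambda>r. (\<Sum>s = 1..r. Y s) mod B)"
  using assms
proof (induction n)
  case 0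
  thus ?case by (simp add: descents_def)
next
  case (Suc n)
  let ?S = "\<lambda>r. \<Sum>s = 1..r. Y s"
  let ?P = "\<lambda>r. ?S (r + 1) mod B < ?S r mod B"
  show ?case
  proof (cases "n = 0")
    \<comment> \<open>A single summand leaves no adjacent pair to compare, and being below
      \<open>B\<close> it has quotient 0.\<close>
    case True
    thus ?thesis using Suc.prems by (simp add: descents_def)
  next
    case False
    \<comment> \<open>Summand \<open>n + 1\<close> adds exactly one candidate descent, the one at
      position \<open>n\<close>.\<close>
    have "{1..n} = insert n {1..n - 1}" using False by auto
    hence split: "{r \<in> {1..n}. ?P r} = {r \<in> {1..n - 1}. ?P r} \<union> (if ?P n then {n} else {})"
      by auto
    have "card {r \<in> {1..n}. ?P r} = card {r \<in> {1..n - 1}. ?P r} + (if ?P n then 1 else 0)"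
      unfolding split using False by (subst card_Un_disjoint) auto
    moreover have "?S n div B = card {r \<in> {1..n - 1}. ?P r}"
      using Suc by (simp add: descents_def)
    ultimately show ?thesis
      using div_add_wrap[of "Y (Suc n)" B "?S n"] Suc.prems[of "Suc n"]
      by (simp add: descents_def)
  qed
qed

text \<open>Consecutive partial sums differ by one summand, and addition can be cancelled modulo
  \<open>B\<close>; this undoes the passage to partial sums.\<close>

lemma sum_cong_inject:
  fixes Y Y' :: "nat \<Rightarrow> nat"
  assumes "\<And>r. r \<in> {1..n} \<Longrightarrow> [(\<Sum>s = 1..r. Y s) = (\<Sum>s = 1..r. Y' s)] (mod B)"
    and "r \<in> {1..n}"
  shows "[Y r = Y' r] (mod B)"
proof -
  obtain l where l: "r = Suc l" using assms(2) by (cases r) auto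
  \<comment> \<open>The value \<open>l = 0\<close> lies outside the range of the assumption, but
    there both sums are empty.\<close>
  have eq: "[(\<Sum>s = 1..l. Y s) = (\<Sum>s = 1..l. Y' s)] (mod B)"
    using assms l by (cases "l = 0") auto
  have "[(\<Sum>s = 1..l. Y s) + Y r = (\<Sum>s = 1..l. Y s) + Y' r] (mod B)"
    using assms(1)[OF assms(2)] cong_add[OF eq cong_refl[of "Y' r"]]
    by (auto simp: l intro: cong_trans cong_sym)
  thus ?thesis by (simp add: cong_add_lcancel_nat)
qed

text \<open>The partial sums of the \<open>n\<close> summands modulo \<open>b ^ m\<close> determine
  the summands, hence all digits. Both spaces have \<open>b ^ (m * n)\<close> elements, so this is a
  bijection, and \<open>sum_div_eq_descents\<close> turns carries into descents.\<close>

lemma card_carries: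
  assumes "b > 0"
  shows "card {x \<in> ({1..m} \<times> {1..n}) \<rightarrow>\<^sub>E {0..<b}. \<forall>j\<in>{1..m}. carry b n (curry x) j = i j} =
   card {W \<in> {1..n} \<rightarrow>\<^sub>E {0..<b ^ m}. \<forall>j\<in>{1..m}. descents n (\<lambda>r. W r mod b ^ j) = i j}"
proof -
  let ?D = "({1..m} \<times> {1..n}) \<rightarrow>\<^sub>E {0..<b}" and ?E = "{1..n} \<rightarrow>\<^sub>E {0..<b ^ m}"
  define Y where "Y j x r = radix_val b j (\<lambda>k. x (k, r))" for j and x :: "nat \<times> nat \<Rightarrow> nat" and r
  define W where "W x = (\<lambda>r\<in>{1..n}. (\<Sum>s = 1..r. Y m x s) mod b ^ m)" for x
  have less: "x (k, r) < b" if "x \<in> ?D" "k \<in> {1..m}" "r \<in> {1..n}" for x k r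
    using that by (force simp: PiE_iff)
  have W_descents: "carry b n (curry x) j = descents n (\<lambda>r. W x r mod b ^ j)"
    if x: "x \<in> ?D" and j: "j \<in> {1..m}" for x j
  proof -
    have "carry b n (curry x) j = (\<Sum>r = 1..n. Y j x r) div b ^ j"
      using assms by (simp add: carry_eq_div Y_def)
    also have "\<dots> = descents n (\<lambda>r. (\<Sum>s = 1..r. Y j x s) mod b ^ j)"
      using x j less by (intro sum_div_eq_descents) (auto simp: Y_def intro!: radix_val_less)
    also have "\<dots> = descents n (\<lambda>r. W x r mod b ^ j)"
    proof -
      have "(\<Sum>s = 1..r. Y j x s) mod b ^ j = W x r mod b ^ j" if r: "r \<in> {1..n}" for r
      proof -
        \<comment> \<open>Since \<open>b ^ j\<close> divides \<open>b ^ m\<close>, the outer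
          reduction modulo \<open>b ^ m\<close> does not affect residues modulo
          \<open>b ^ j\<close>; thus the same \<open>W x\<close> works for every column.\<close>
        have "W x r mod b ^ j = (\<Sum>s = 1..r. Y m x s) mod b ^ j"
          using r j by (simp add: W_def mod_mod_cancel le_imp_power_dvd)
        also have "\<dots> = (\<Sum>s = 1..r. Y m x s mod b ^ j) mod b ^ j"
          by (simp add: mod_sum_eq)
        also have "(\<Sum>s = 1..r. Y m x s mod b ^ j) = (\<Sum>s = 1..r. Y j x s)"
          unfolding Y_def using x j r less by (intro sum.cong refl radix_val_mod) auto
        finally show ?thesis by simp
      qed
      thus ?thesis by (rule descents_cong)
    qed
    finally show ?thesis .
  qed
  have "inj_on W ?D"
  proof (rule inj_onI)
    fix x x' assume x: "x \<in> ?D" "x' \<in> ?D" and eq: "W x = W x'"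
    have "x (k, r) = x' (k, r)" if "k \<in> {1..m}" "r \<in> {1..n}" for k r
    proof (rule radix_val_inject[OF _ _ _ that(1)])
      have "[(\<Sum>s = 1..u. Y m x s) = (\<Sum>s = 1..u. Y m x' s)] (mod b ^ m)" if "u \<in> {1..n}" for u
        using fun_cong[OF eq, of u] that by (simp add: W_def cong_def)
      hence "[Y m x r = Y m x' r] (mod b ^ m)"
        using that(2) by (rule sum_cong_inject)
      moreover have "Y m x r < b ^ m" "Y m x' r < b ^ m"
        using x less that by (auto simp: Y_def intro!: radix_val_less)
      ultimately show "radix_val b m (\<lambda>k. x (k, r)) = radix_val b m (\<lambda>k. x' (k, r))"
        by (simp add: cong_def Y_def)
    qed (use less[OF x(1)] less[OF x(2)] that in auto)
    thus "x = x'" by (intro PiE_ext[OF x]) auto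
  qed
  moreover have "W ` ?D \<subseteq> ?E"
    using assms by (auto simp: W_def)
  moreover have "card ?D = card ?E"
    by (simp add: card_PiE card_cartesian_product flip: power_mult)
  ultimately have "card {x \<in> ?D. \<forall>j\<in>{1..m}. descents n (\<lambda>r. W x r mod b ^ j) = i j} =
      card {W \<in> ?E. \<forall>j\<in>{1..m}. descents n (\<lambda>r. W r mod b ^ j) = i j}"
    by (intro card_Collect_inj_on) (auto simp: finite_PiE)
  thus ?thesis using W_descents by (simp cong: conj_cong)
qed


section \<open>From the two counts to the two joint laws\<close>

theorem theorem3p1:
  fixes n b m :: nat
    and M :: "'a measure" and X :: "nat \<Rightarrow> nat \<Rightarrow> 'a \<Rightarrow> nat"
    and N :: "'b measure" and A :: "nat \<Rightarrow> 'b \<Rightarrow> nat \<Rightarrow> nat"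
    and i :: "nat \<Rightarrow> nat"
  assumes "n \<ge> 2" and "b \<ge> 2" and "m \<ge> 1"
    and "prob_space M"
    and "prob_space.indep_vars M (\<lambda>_. count_space {0..<b}) (\<lambda>(j, r). X j r) ({1..m} \<times> {1..n})"
    and "\<And>j r. j \<in> {1..m} \<Longrightarrow> r \<in> {1..n} \<Longrightarrow>
           distr M (count_space {0..<b}) (X j r) = uniform_count_measure {0..<b}"
    and "prob_space N"
    and "prob_space.indep_vars N (\<lambda>_. count_space ({1..n} \<rightarrow>\<^sub>E {0..<b})) A {1..}"
    and "\<And>j. j \<ge> 1 \<Longrightarrow>
           distr N (count_space ({1..n} \<rightarrow>\<^sub>E {0..<b})) (A j) =
             uniform_count_measure ({1..n} \<rightarrow>\<^sub>E {0..<b})"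
  shows "measure M {\<omega> \<in> space M. \<forall>j \<in> {1..m}. carry b n (\<lambda>j r. X j r \<omega>) j = i j} =
         measure N {\<omega> \<in> space N. \<forall>j \<in> {1..m}. descents n (iterated_shuffle n (\<lambda>j. A j \<omega>) j) = i j}"
proof -
  let ?I = "{1..m} \<times> {1..n}" and ?V = "{1..n} \<rightarrow>\<^sub>E {0..<b}"
  interpret M: prob_space M by fact
  interpret N: prob_space N by fact
  have V: "finite ?V" "?V \<noteq> {}" using \<open>b \<ge> 2\<close> by (auto simp: finite_PiE PiE_eq_empty_iff)

  \<comment> \<open>The carries depend only on the digits in \<open>?I\<close>, so the event can be
    expressed through the restricted family, the form that \<open>prob_indep_uniform\<close>
    expects.\<close>
  have "carry b n (\<lambda>j r. X j r \<omega>) j = carry b n (curry (\<lambda>p\<in>?I. case_prod X p \<omega>)) j"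
    if "j \<in> {1..m}" for j \<omega>
    using that by (intro carry_cong) auto
  hence "measure M {\<omega> \<in> space M. \<forall>j \<in> {1..m}. carry b n (\<lambda>j r. X j r \<omega>) j = i j} =
      M.prob {\<omega> \<in> space M. \<forall>j\<in>{1..m}. carry b n (curry (\<lambda>p\<in>?I. case_prod X p \<omega>)) j = i j}"
    by simp
  also have "\<dots> = card {x \<in> ?I \<rightarrow>\<^sub>E {0..<b}. \<forall>j\<in>{1..m}. carry b n (curry x) j = i j} /
      real (card {0..<b}) ^ card ?I"
    using assms by (intro M.prob_indep_uniform) auto
  \<comment> \<open>Both numerators count the same set of functions \<open>W\<close>, and the
    denominators \<open>b ^ (m * n)\<close> and \<open>(b ^ n) ^ m\<close> agree.\<close>
  also have "\<dots> = card {F \<in> {1..m} \<rightarrow>\<^sub>E ?V. \<forall>j\<in>{1..m}. descents n (iterated_shuffle n F j) = i j} /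
      real (card ?V) ^ card {1..m}"
    using \<open>b \<ge> 2\<close> card_carries[of b m n i] card_shuffles[of m n b i]
    by (simp add: card_PiE mult.commute flip: power_mult)
  also have "\<dots> = N.prob {\<omega> \<in> space N. \<forall>j\<in>{1..m}.
      descents n (iterated_shuffle n (\<lambda>k\<in>{1..m}. A k \<omega>) j) = i j}"
  proof (rule N.prob_indep_uniform[symmetric])
    \<comment> \<open>Only the first \<open>m\<close> vectors of the infinite sequence enter the
      event, so independence is restricted to a finite index set, nonempty by
      \<open>m \<ge> 1\<close>.\<close>
    show "N.indep_vars (\<lambda>_. count_space ?V) A {1..m}"
      using assms(8) by (rule N.indep_vars_subset) auto
  qed (use assms(3,9) V in auto)
  also have "\<dots> = measure N {\<omega> \<in> space N. \<forall>j \<in> {1..m}.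
      descents n (iterated_shuffle n (\<lambda>j. A j \<omega>) j) = i j}"
  proof -
    have "iterated_shuffle n (\<lambda>k\<in>{1..m}. A k \<omega>) j = iterated_shuffle n (\<lambda>j. A j \<omega>) j"
      if "j \<in> {1..m}" for j \<omega>
      using that by (intro iterated_shuffle_cong) auto
    thus ?thesis by simp
  qed
  finally show ?thesis .
qed

end
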